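(* Let $\epsilon\in(0,1/2)$ and consider the two-armed action-dependent Bernoulli bandit instance with mean reward functions $$r_1(p)=\begin{cases}\dfrac{p}{1-\epsilon},&0\le p\le 1-\epsilon,\\ 2-\epsilon-p,&1-\epsilon\le p\le 1,\end{cases}\qquad r_2(p)=\begin{cases}\dfrac{p}{2\epsilon},&0\le p\le\epsilon,\\ -\tfrac12p+\tfrac12(1+\epsilon),&\epsilon\le p\le1.\end{cases}$$ Then Thompson Sampling, run on the two base arms while ignoring the impact of its own actions (i.e. treating the sample means as the true mean rewards of the arms; described in the context), suffers linear regret on this instance.
   Context: Thompson Sampling: initialize $S_i=F_i=0$ for $i=1,2$. In each round $t=1,2,\dots$, for each arm $i\in\{1,2\}$ sample independently $\theta_i(t)\sim\mathrm{Beta}(S_i+1,F_i+1)$, play $a_t=\arg\max_i\theta_i(t)$, observe a reward $\tilde r_t\in\{0,1\}$; if $\tilde r_t=1$ set $S_{a_t}\leftarrow S_{a_t}+1$, otherwise $F_{a_t}\leftarrow F_{a_t}+1$. Action-dependent rewards: let $\mathbf p(t)=(p_1(t),p_2(t))$ with $p_i(t)$ the conditional probability, given the history before round $t$, that the algorithm plays arm $i$ in round $t$. If arm $i$ is played in round $t$, the observed reward is Bernoulli with mean $r_i(p_i(t))$. The utility of a mixed strategy is $U(\mathbf p)=p_1r_1(p_1)+p_2r_2(p_2)$, and the regret is $\mathrm{Reg}(T)=T\sup_{\mathbf p}U(\mathbf p)-\mathbb E[\sum_{t=1}^TU(\mathbf p(t))]$, the supremum being over all probability vectors $\mathbf p=(p_1,p_2)$.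 (The optimal strategy is $\mathbf p^*=(1-\epsilon,\epsilon)$.) "Suffers linear regret" means that the regret is not sublinear: $\mathrm{Reg}(T)$ is not $o(T)$. *)

theory Defs
  imports "HOL-Probability.Probability" "HOL-Library.Landau_Symbols"
begin

definition beta_density :: "real \<Rightarrow> real \<Rightarrow> real \<Rightarrow> real" where
  "beta_density a b x =
     (if 0 < x \<and> x < 1 then x powr (a - 1) * (1 - x) powr (b - 1) / Beta a b else 0)"

definition beta_measure :: "real \<Rightarrow> real \<Rightarrow> real measure" where
  "beta_measure a b = density lborel (\<lambda>x. ennreal (beta_density a b x))"

lemma measurable_beta_density [measurable]: "beta_density a b \<in> borel_measurable borel"
  unfolding beta_density_def[abs_def] by measurable

lemma sets_beta_measure [simp, measurable_cong]: "sets (beta_measure a b) = sets borel"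
  by (simp add: beta_measure_def)

lemma prob_space_beta_measure:
  assumes "0 < a" "0 < b"
  shows "prob_space (beta_measure a b)"
proof
  have pos: "0 < Beta a b"
    using assms by (simp add: Beta_def Gamma_real_pos)
  have hi: "((\<lambda>t. t powr (a - 1) * (1 - t) powr (b - 1)) has_integral Beta a b) {0<..<1}"
    using has_integral_Beta_real[OF assms] by (simp add: has_integral_Icc_iff_Ioo)
  have "((\<lambda>t. t powr (a - 1) * (1 - t) powr (b - 1) / Beta a b) has_integral Beta a b / Beta a b) {0<..<1}"
    by (rule has_integral_divide[OF hi])
  hence "((\<lambda>x. if x \<in> {0<..<1} then x powr (a - 1) * (1 - x) powr (b - 1) / Beta a b else 0)
      has_integral 1) UNIV"
    using pos by (subst has_integral_restrict_UNIV) simp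
  hence "(beta_density a b has_integral 1) UNIV"
    by (simp add: beta_density_def[abs_def] cong: if_cong)
  moreover have "0 \<le> beta_density a b x" for x
    using pos by (simp add: beta_density_def)
  ultimately have "(\<integral>\<^sup>+x. ennreal (beta_density a b x) \<partial>lborel) = 1"
    by (subst nn_integral_has_integral_lborel[of "beta_density a b" 1]) auto
  thus "emeasure (beta_measure a b) (space (beta_measure a b)) = 1"
    by (simp add: beta_measure_def emeasure_density)
qed

datatype arm = Arm1 | Arm2

text \<open>A history lists, oldest round first, the arm played and whether the reward was 1.\<close>

type_synonym history = "(arm \<times> bool) list"

definition successes :: "history \<Rightarrow> arm \<Rightarrow> nat" where
  "successes h i = count_list h (i, True)"

definition failures :: "history \<Rightarrow> arm \<Rightarrow> nat" where
  "failures h i = count_list h (i, False)"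

definition posterior :: "history \<Rightarrow> arm \<Rightarrow> real measure" where
  "posterior h i = beta_measure (real (successes h i) + 1) (real (failures h i) + 1)"

definition sample_law :: "history \<Rightarrow> (real \<times> real) measure" where
  "sample_law h = posterior h Arm1 \<Otimes>\<^sub>M posterior h Arm2"

text \<open>Ties have probability zero; they are broken in favour of the first arm.\<close>

definition argmax_arm :: "real \<times> real \<Rightarrow> arm" where
  "argmax_arm \<theta> = (if snd \<theta> \<le> fst \<theta> then Arm1 else Arm2)"

definition play_prob :: "history \<Rightarrow> arm \<Rightarrow> real" where
  "play_prob h i = measure (sample_law h) {\<theta> \<in> space (sample_law h). argmax_arm \<theta> = i}"

text \<open>
  Law of the pair (arm played, reward) in the round following the history \<open>h\<close>.  The mean
  reward of the arm that is played is evaluated at the probability with which it is played.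
\<close>

definition round_law :: "(arm \<Rightarrow> real \<Rightarrow> real) \<Rightarrow> history \<Rightarrow> (arm \<times> bool) measure" where
  "round_law r h =
     sample_law h \<bind> (\<lambda>\<theta>. let i = argmax_arm \<theta> in
       distr (measure_pmf (bernoulli_pmf (r i (play_prob h i)))) (count_space UNIV) (\<lambda>x. (i, x)))"

primrec history_law :: "(arm \<Rightarrow> real \<Rightarrow> real) \<Rightarrow> nat \<Rightarrow> history measure" where
  "history_law r 0 = return (count_space UNIV) []"
| "history_law r (Suc t) =
     history_law r t \<bind> (\<lambda>h. distr (round_law r h) (count_space UNIV) (\<lambda>z. h @ [z]))"

definition utility :: "(arm \<Rightarrow> real \<Rightarrow> real) \<Rightarrow> (arm \<Rightarrow> real) \<Rightarrow> real" where
  "utility r p = p Arm1 * r Arm1 (p Arm1) + p Arm2 * r Arm2 (p Arm2)"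

definition mixed_strategies :: "(arm \<Rightarrow> real) set" where
  "mixed_strategies = {p. 0 \<le> p Arm1 \<and> 0 \<le> p Arm2 \<and> p Arm1 + p Arm2 = 1}"

text \<open>
  Rounds are numbered from 0 here, so \<open>take t h\<close> is the history before round \<open>t\<close> and
  \<open>play_prob (take t h)\<close> is the mixed strategy used in that round.
\<close>

definition regret :: "(arm \<Rightarrow> real \<Rightarrow> real) \<Rightarrow> nat \<Rightarrow> real" where
  "regret r T = real T * (SUP p\<in>mixed_strategies. utility r p)
     - (\<integral>h. (\<Sum>t<T. utility r (play_prob (take t h))) \<partial>history_law r T)"

definition linear_regret :: "(nat \<Rightarrow> real) \<Rightarrow> bool" where
  "linear_regret R \<longleftrightarrow> R \<notin> o(\<lambda>T. real T)"

text \<open>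
  Only the values on \<open>[0, 1]\<close> matter; there they lie in \<open>[0, 1]\<close> when \<open>0 < \<epsilon> < 1 / 2\<close>.
\<close>

fun instance_reward :: "real \<Rightarrow> arm \<Rightarrow> real \<Rightarrow> real" where
  "instance_reward \<epsilon> Arm1 p = (if p \<le> 1 - \<epsilon> then p / (1 - \<epsilon>) else 2 - \<epsilon> - p)"
| "instance_reward \<epsilon> Arm2 p = (if p \<le> \<epsilon> then p / (2 * \<epsilon>) else - (1 / 2) * p + (1 / 2) * (1 + \<epsilon>))"

lemma UNIV_arm: "UNIV = {Arm1, Arm2}"
  using arm.exhaust by auto

instance arm :: finite
  by standard (simp add: UNIV_arm)

lemma prob_space_posterior: "prob_space (posterior h i)"
  unfolding posterior_def by (rule prob_space_beta_measure) auto

lemma sets_sample_law [simp, measurable_cong]: "sets (sample_law h) = sets borel"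
proof -
  have "sets (sample_law h) = sets ((borel :: real measure) \<Otimes>\<^sub>M (borel :: real measure))"
    unfolding sample_law_def posterior_def by (intro sets_pair_measure_cong sets_beta_measure)
  thus ?thesis by (simp only: borel_prod)
qed

lemma prob_space_sample_law: "prob_space (sample_law h)"
proof -
  interpret P: pair_prob_space "posterior h Arm1" "posterior h Arm2"
    by (simp add: pair_prob_space_def pair_sigma_finite_def prob_space_posterior
        prob_space_imp_sigma_finite)
  show ?thesis unfolding sample_law_def by (rule P.P.prob_space_axioms)
qed

lemma measurable_argmax_arm [measurable]: "argmax_arm \<in> borel \<rightarrow>\<^sub>M count_space UNIV"
proof -
  have "(\<lambda>\<theta>::real\<times>real. if snd \<theta> \<le> fst \<theta> then Arm1 else Arm2) \<in> borel \<Otimes>\<^sub>M borel \<rightarrow>\<^sub>M count_space UNIV"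
    by measurable
  thus ?thesis by (simp add: argmax_arm_def[abs_def] borel_prod)
qed

lemma round_law_kernel:
  "(\<lambda>\<theta>. let i = argmax_arm \<theta> in
       distr (measure_pmf (bernoulli_pmf (r i (play_prob h i)))) (count_space UNIV) (\<lambda>x. (i, x)))
     \<in> sample_law h \<rightarrow>\<^sub>M prob_algebra (count_space UNIV)"
proof -
  have "(\<lambda>i. distr (measure_pmf (bernoulli_pmf (r i (play_prob h i)))) (count_space UNIV) (\<lambda>x. (i, x)))
     \<in> count_space UNIV \<rightarrow>\<^sub>M prob_algebra (count_space UNIV)"
    by (auto simp: space_prob_algebra intro!: prob_space.prob_space_distr measure_pmf.prob_space_axioms)
  from measurable_compose[OF measurable_argmax_arm this] show ?thesis
    by (simp add: Let_def cong: measurable_cong_sets)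
qed

lemma sample_law_in_prob_algebra: "sample_law h \<in> space (prob_algebra borel)"
  by (simp add: space_prob_algebra prob_space_sample_law)

lemma round_law_kernel':
  "(\<lambda>\<theta>. let i = argmax_arm \<theta> in
       distr (measure_pmf (bernoulli_pmf (r i (play_prob h i)))) (count_space UNIV) (\<lambda>x. (i, x)))
     \<in> borel \<rightarrow>\<^sub>M prob_algebra (count_space UNIV)"
  using round_law_kernel[of r h] by (simp cong: measurable_cong_sets)

lemma sets_round_law [simp, measurable_cong]: "sets (round_law r h) = UNIV"
  unfolding round_law_def
  using sets_bind'[OF sample_law_in_prob_algebra round_law_kernel', of h r] by simp

lemma prob_space_round_law: "prob_space (round_law r h)"
  unfolding round_law_def
  by (rule prob_space_bind'[OF sample_law_in_prob_algebra round_law_kernel'])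

lemma emeasure_round_law:
  "emeasure (round_law r h) {(i, x)} =
     ennreal (play_prob h i) * ennreal (pmf (bernoulli_pmf (r i (play_prob h i))) x)"
proof -
  interpret prob_space "sample_law h" by (rule prob_space_sample_law)
  have "emeasure (round_law r h) {(i, x)} =
    (\<integral>\<^sup>+\<theta>. emeasure (let i = argmax_arm \<theta> in
       distr (measure_pmf (bernoulli_pmf (r i (play_prob h i)))) (count_space UNIV) (\<lambda>x. (i, x))) {(i, x)}
       \<partial>sample_law h)"
    unfolding round_law_def
    by (rule emeasure_bind_prob_algebra[OF sample_law_in_prob_algebra round_law_kernel']) simp
  also have "\<dots> = (\<integral>\<^sup>+\<theta>. ennreal (pmf (bernoulli_pmf (r i (play_prob h i))) x) *
        indicator {\<theta> \<in> space (sample_law h). argmax_arm \<theta> = i} \<theta> \<partial>sample_law h)"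
  proof (rule nn_integral_cong)
    fix \<theta> assume th: "\<theta> \<in> space (sample_law h)"
    have "Pair (argmax_arm \<theta>) -` {(i, x)} = (if argmax_arm \<theta> = i then {x} else {})" by auto
    thus "emeasure (let i = argmax_arm \<theta> in
       distr (measure_pmf (bernoulli_pmf (r i (play_prob h i)))) (count_space UNIV) (\<lambda>x. (i, x))) {(i, x)}
       = ennreal (pmf (bernoulli_pmf (r i (play_prob h i))) x) *
        indicator {\<theta> \<in> space (sample_law h). argmax_arm \<theta> = i} \<theta>"
      using th by (auto simp: Let_def emeasure_distr emeasure_pmf_single)
  qed
  also have "\<dots> = ennreal (play_prob h i) * ennreal (pmf (bernoulli_pmf (r i (play_prob h i))) x)"
    by (subst nn_integral_cmult_indicator) (auto simp: play_prob_def emeasure_eq_measure mult.commute)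
  finally show ?thesis .
qed

lemma history_law_in_prob_algebra: "history_law r t \<in> space (prob_algebra (count_space UNIV))"
proof (induction t)
  case 0
  show ?case by (simp add: space_prob_algebra prob_space_return)
next
  case (Suc t)
  have K: "(\<lambda>h. distr (round_law r h) (count_space UNIV) (\<lambda>z. h @ [z]))
      \<in> count_space UNIV \<rightarrow>\<^sub>M prob_algebra (count_space UNIV)"
    by (auto simp: space_prob_algebra measurable_def intro!: prob_space.prob_space_distr prob_space_round_law)
  show ?case
    using sets_bind'[OF Suc K] prob_space_bind'[OF Suc K] by (simp add: space_prob_algebra)
qed

lemma prob_space_history_law: "prob_space (history_law r t)"
  and sets_history_law [simp, measurable_cong]: "sets (history_law r t) = UNIV"
  using history_law_in_prob_algebra[of r t] by (auto simp: space_prob_algebra)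

text \<open>
  The conditional probability, given that the history before round \<open>t\<close> is \<open>h\<close>, of playing arm
  \<open>i\<close> in that round and obtaining reward \<open>x\<close>; in particular \<open>play_prob h i\<close> is the conditional
  probability of playing \<open>i\<close>.
\<close>

lemma emeasure_history_law_Suc:
  "emeasure (history_law r (Suc t)) {h @ [(i, x)]} =
     emeasure (history_law r t) {h} *
       (ennreal (play_prob h i) * ennreal (pmf (bernoulli_pmf (r i (play_prob h i))) x))"
proof -
  have K: "(\<lambda>h. distr (round_law r h) (count_space UNIV) (\<lambda>z. h @ [z]))
      \<in> count_space UNIV \<rightarrow>\<^sub>M prob_algebra (count_space UNIV)"
    by (auto simp: space_prob_algebra measurable_def intro!: prob_space.prob_space_distr prob_space_round_law)
  have "emeasure (history_law r (Suc t)) {h @ [(i, x)]} =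
    (\<integral>\<^sup>+h'. emeasure (distr (round_law r h') (count_space UNIV) (\<lambda>z. h' @ [z])) {h @ [(i, x)]}
       \<partial>history_law r t)"
    unfolding history_law.simps
    by (rule emeasure_bind_prob_algebra[OF history_law_in_prob_algebra K]) simp
  also have "\<dots> = (\<integral>\<^sup>+h'. emeasure (round_law r h) {(i, x)} * indicator {h} h' \<partial>history_law r t)"
  proof (rule nn_integral_cong)
    fix h'
    have "space (round_law r h') = UNIV"
      using sets_eq_imp_space_eq[of "round_law r h'" "count_space UNIV"] by simp
    moreover have "(\<lambda>z. h' @ [z]) -` {h @ [(i, x)]} = (if h' = h then {(i, x)} else {})" by auto
    ultimately show "emeasure (distr (round_law r h') (count_space UNIV) (\<lambda>z. h' @ [z])) {h @ [(i, x)]}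
        = emeasure (round_law r h) {(i, x)} * indicator {h} h'"
      by (subst emeasure_distr) (auto simp: measurable_def)
  qed
  also have "\<dots> = emeasure (round_law r h) {(i, x)} * emeasure (history_law r t) {h}"
    by (rule nn_integral_cmult_indicator) simp
  finally show ?thesis by (simp add: emeasure_round_law mult.commute)
qed

end

theory Submission
  imports Defs
begin

text \<open>
  Write \<open>s\<^sub>t\<close> for the probability of playing the second arm in round \<open>t\<close>, \<open>n\<^sub>i\<close> for the number of
  plays of arm \<open>i\<close> and \<open>F\<^sub>i\<close> for its number of failures. The utility gap is at least
  \<open>\<bar>s - \<epsilon>\<bar> / 2\<close>, so sublinear regret forces \<open>s\<^sub>t\<close> to be close to \<open>\<epsilon>\<close> on average. Near \<open>\<epsilon>\<close> the
  first arm almost never fails while the second fails about half of the time, so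
  \<open>E F\<^sub>1 = o(t)\<close> but \<open>E (n\<^sub>1 F\<^sub>2)\<close> grows like \<open>t\<^sup>2\<close>. On the other hand the posteriors satisfy
  \<open>P(\<theta>\<^sub>2 > \<theta>\<^sub>1) \<le> E (1 - \<theta>\<^sub>1) * E (1 / (1 - \<theta>\<^sub>2))\<close>, which gives
  \<open>s\<^sub>t n\<^sub>1 F\<^sub>2 \<le> (F\<^sub>1 + 1) (t + 1)\<close>. In expectation the left side is of order \<open>t\<^sup>2\<close> for suitable
  large \<open>t\<close>, the right side is \<open>o(t\<^sup>2)\<close>. Only first moments enter; no concentration
  inequality is needed.
\<close>

section \<open>Beta moments and a bound on the probability of playing the second arm\<close>

text \<open>Multiplying the Beta density by a power of \<open>1 - x\<close> yields another Beta
  density up to the ratio of normalising constants. Only \<open>c = 1\<close> and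
  \<open>c = -1\<close> occur below, the moments of \<open>1 - \<theta>\<^sub>1\<close> and
  \<open>1 / (1 - \<theta>\<^sub>2)\<close>.\<close>

lemma nn_integral_beta_measure_powr:
  assumes "0 < a" "0 < b" "0 < b + c"
  shows "(\<integral>\<^sup>+x. ennreal ((1 - x) powr c) \<partial>beta_measure a b) = ennreal (Beta a (b + c) / Beta a b)"
proof -
  have pos: "0 < Beta a b" "0 < Beta a (b + c)"
    using assms by (simp_all add: Beta_def Gamma_real_pos)
  have shift: "ennreal (beta_density a b x) * ennreal ((1 - x) powr c)
      = ennreal (Beta a (b + c) / Beta a b) * ennreal (beta_density a (b + c) x)" for x
  proof (cases "0 < x \<and> x < 1")
    case True
    have "(1 - x) powr (b + c - 1) = (1 - x) powr (b - 1) * (1 - x) powr c"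
      by (simp add: powr_add[symmetric] algebra_simps)
    then show ?thesis
      using True pos by (simp add: beta_density_def ennreal_mult[symmetric] field_simps)
  qed (auto simp: beta_density_def)
  interpret B: prob_space "beta_measure a (b + c)"
    by (rule prob_space_beta_measure) (use assms in auto)
  have one: "(\<integral>\<^sup>+x. ennreal (beta_density a (b + c) x) \<partial>lborel) = 1"
    using B.emeasure_space_1 by (simp add: beta_measure_def emeasure_density)
  have "(\<integral>\<^sup>+x. ennreal ((1 - x) powr c) \<partial>beta_measure a b)
      = (\<integral>\<^sup>+x. ennreal (beta_density a b x) * ennreal ((1 - x) powr c) \<partial>lborel)"
    unfolding beta_measure_def by (subst nn_integral_density) auto
  also have "\<dots> = ennreal (Beta a (b + c) / Beta a b) * (\<integral>\<^sup>+x. ennreal (beta_density a (b + c) x) \<partial>lborel)"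
    by (simp add: shift nn_integral_cmult)
  finally show ?thesis by (simp add: one)
qed

lemma AE_beta_measure: "AE x in beta_measure a b. 0 < x \<and> x < 1"
  unfolding beta_measure_def by (subst AE_density) (auto simp: beta_density_def)

lemma play_prob_nonneg: "0 \<le> play_prob h i"
  by (simp add: play_prob_def)

lemma play_prob_Arm1: "play_prob h Arm1 = 1 - play_prob h Arm2"
proof -
  interpret prob_space "sample_law h" by (rule prob_space_sample_law)
  have "{\<theta> \<in> space (sample_law h). argmax_arm \<theta> = Arm2} \<in> events"
    by measurable
  from prob_compl[OF this] show ?thesis
    unfolding play_prob_def
    by (smt (verit) Collect_cong arm.distinct(1) arm.exhaust set_diff_eq mem_Collect_eq)
qed

lemma play_prob_le_1: "play_prob h i \<le> 1"
  using play_prob_Arm1[of h] play_prob_nonneg[of h Arm1] play_prob_nonneg[of h Arm2]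
  by (cases i) auto

text \<open>
  Markov's inequality for the ratio \<open>(1 - \<theta>\<^sub>1) / (1 - \<theta>\<^sub>2)\<close>, which is at least 1 whenever the
  second arm wins.
\<close>

lemma play_prob_Arm2_le:
  assumes "0 < failures h Arm2"
  shows "play_prob h Arm2 \<le>
    (real (failures h Arm1) + 1) / (real (successes h Arm1) + real (failures h Arm1) + 2) *
    ((real (successes h Arm2) + real (failures h Arm2) + 1) / real (failures h Arm2))"
    (is "_ \<le> ?m1 * ?m2")
proof -
  interpret P: pair_prob_space "posterior h Arm1" "posterior h Arm2"
    by (simp add: pair_prob_space_def pair_sigma_finite_def prob_space_posterior
        prob_space_imp_sigma_finite)
  interpret S: prob_space "sample_law h" by (rule prob_space_sample_law)
  define f g :: "real \<Rightarrow> real" where "f x = (1 - x) powr 1" and "g x = (1 - x) powr (- 1)" for x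
  have [measurable]: "f \<in> borel_measurable borel" "g \<in> borel_measurable borel"
    unfolding f_def[abs_def] g_def[abs_def] by measurable
  have sets_post [measurable_cong]: "sets (posterior h i) = sets borel" for i
    by (simp add: posterior_def)
  have m1: "(\<integral>\<^sup>+x. ennreal (f x) \<partial>posterior h Arm1) = ennreal ?m1"
  proof -
    let ?a = "real (successes h Arm1) + 1" and ?b = "real (failures h Arm1) + 1"
    have "(?a + ?b) * Beta ?a (?b + 1) = ?b * Beta ?a ?b"
      by (rule Beta_plus1_right) (auto simp: nonpos_Ints_def)
    moreover have "0 < Beta ?a ?b" by (simp add: Beta_def Gamma_real_pos)
    ultimately have "Beta ?a (?b + 1) / Beta ?a ?b = ?m1"
      by (simp add: field_simps)
    then show ?thesis
      unfolding f_def posterior_def by (subst nn_integral_beta_measure_powr) auto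
  qed
  \<comment> \<open>The posterior parameter is \<open>failures h Arm2 + 1\<close>, so the exponent
    \<open>-1\<close> lowers it to \<open>failures h Arm2\<close>. This is where a failure of the
    second arm must have been seen.\<close>
  have m2: "(\<integral>\<^sup>+x. ennreal (g x) \<partial>posterior h Arm2) = ennreal ?m2"
  proof -
    let ?a = "real (successes h Arm2) + 1" and ?b = "real (failures h Arm2)"
    have "(?a + ?b) * Beta ?a (?b + 1) = ?b * Beta ?a ?b"
      by (rule Beta_plus1_right) (use assms in \<open>auto elim!: nonpos_Ints_cases\<close>)
    moreover have "0 < Beta ?a (?b + 1)" by (simp add: Beta_def Gamma_real_pos)
    ultimately have "Beta ?a ?b / Beta ?a (?b + 1) = ?m2"
      using assms by (simp add: field_simps)
    then show ?thesis
      using assms unfolding g_def posterior_def by (subst nn_integral_beta_measure_powr) auto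
  qed
  \<comment> \<open>The ratio bound can fail on the boundary: at \<open>snd \<theta> = 1\<close> the
    convention \<open>0 powr _ = 0\<close> makes \<open>g\<close> vanish although the second arm may
    win. Hence the restriction to the open unit square.\<close>
  have ae: "AE \<theta> in sample_law h. (0 < fst \<theta> \<and> fst \<theta> < 1) \<and> (0 < snd \<theta> \<and> snd \<theta> < 1)"
  proof -
    have post: "AE x in posterior h i. 0 < x \<and> x < 1" for i
      unfolding posterior_def by (rule AE_beta_measure)
    have "AE x in posterior h Arm1. AE y in posterior h Arm2.
        (0 < fst (x, y) \<and> fst (x, y) < 1) \<and> (0 < snd (x, y) \<and> snd (x, y) < 1)"
      using post[of Arm1]
    proof eventually_elim
      case (elim x)
      show ?case
        using post[of Arm2] by eventually_elim (use elim in auto)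
    qed
    then show ?thesis
      unfolding sample_law_def by (intro P.AE_pair_measure) measurable
  qed
  have "ennreal (play_prob h Arm2) = emeasure (sample_law h) {\<theta> \<in> space (sample_law h). argmax_arm \<theta> = Arm2}"
    by (simp add: play_prob_def S.emeasure_eq_measure)
  also have "\<dots> = (\<integral>\<^sup>+\<theta>. indicator {\<theta> \<in> space (sample_law h). argmax_arm \<theta> = Arm2} \<theta> \<partial>sample_law h)"
    by (rule nn_integral_indicator[symmetric]) measurable
  also have "\<dots> \<le> (\<integral>\<^sup>+\<theta>. ennreal (f (fst \<theta>)) * ennreal (g (snd \<theta>)) \<partial>sample_law h)"
  proof (rule nn_integral_mono_AE, use ae in eventually_elim)
    fix \<theta> :: "real \<times> real"
    assume \<theta>: "(0 < fst \<theta> \<and> fst \<theta> < 1) \<and> (0 < snd \<theta> \<and> snd \<theta> < 1)"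
    show "indicator {\<theta> \<in> space (sample_law h). argmax_arm \<theta> = Arm2} \<theta>
        \<le> ennreal (f (fst \<theta>)) * ennreal (g (snd \<theta>))"
      using \<theta> by (auto simp: f_def g_def argmax_arm_def powr_minus ennreal_mult[symmetric]
          field_simps indicator_def ennreal_ge_1 split: if_splits)
  qed
  also have "\<dots> = (\<integral>\<^sup>+x. \<integral>\<^sup>+y. ennreal (f x) * ennreal (g y) \<partial>posterior h Arm2 \<partial>posterior h Arm1)"
    unfolding sample_law_def by (subst P.M2.nn_integral_fst[symmetric]) auto
  also have "\<dots> = ennreal (?m1 * ?m2)"
    by (simp add: nn_integral_cmult nn_integral_multc m1 m2 ennreal_mult[symmetric])
  finally show ?thesis
    by (subst (asm) ennreal_le_iff) auto
qed

section \<open>Expectations over histories: finite sums and the one-step recursion\<close>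

lemma space_history_law [simp]: "space (history_law r t) = UNIV"
  using sets_eq_imp_space_eq[of "history_law r t" "count_space UNIV"] by simp

lemma measure_history_law_UNIV [simp]: "measure (history_law r t) UNIV = 1"
  using prob_space.prob_space[OF prob_space_history_law] by (metis space_history_law)

lemma AE_history_law_length: "AE h in history_law r t. length h = t"
proof (induction t)
  case 0
  show ?case unfolding history_law.simps by (subst AE_return) auto
next
  case (Suc t)
  have K: "(\<lambda>h. distr (round_law r h) (count_space UNIV) (\<lambda>z. h @ [z]))
      \<in> history_law r t \<rightarrow>\<^sub>M subprob_algebra (count_space UNIV)"
    by (auto simp: measurable_def space_subprob_algebra
        intro!: prob_space_imp_subprob_space prob_space.prob_space_distr prob_space_round_law)
  show ?case
    unfolding history_law.simps
  proof (subst AE_bind[OF K])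
    show "AE h in history_law r t. AE h' in distr (round_law r h) (count_space UNIV) (\<lambda>z. h @ [z]).
        length h' = Suc t"
      using Suc by eventually_elim (subst AE_distr_iff, auto simp: measurable_def)
  qed simp
qed

lemma borel_measurable_history_law [measurable]: "f \<in> borel_measurable (history_law r t)"
  by (simp add: measurable_def)

lemma finite_histories: "finite {h :: history. length h = t}"
  using finite_lists_length_eq[of "UNIV :: (arm \<times> bool) set" t] by simp

lemma integrable_history_law: "integrable (history_law r t) (f :: history \<Rightarrow> real)"
proof -
  interpret prob_space "history_law r t" by (rule prob_space_history_law)
  show ?thesis
  proof (rule integrable_const_bound)
    show "AE h in history_law r t. norm (f h) \<le> (\<Sum>h' | length h' = t. \<bar>f h'\<bar>)"
      using AE_history_law_length[of t r]
      by eventually_elim (auto intro!: member_le_sum[where f = "\<lambda>h. \<bar>f h\<bar>"] simp: finite_histories)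
  qed simp
qed

text \<open>Almost surely a history before round \<open>t\<close> is one of finitely many lists of
  length \<open>t\<close>. Monotonicity then needs checking only on lists of that length, which
  gives access to bounds such as \<open>failures h i \<le> t\<close>.\<close>

lemma integral_history_law:
  "(\<integral>h. f h \<partial>history_law r t) = (\<Sum>h | length h = t. f h * measure (history_law r t) {h})"
  for f :: "history \<Rightarrow> real"
proof -
  interpret prob_space "history_law r t" by (rule prob_space_history_law)
  have "(\<integral>h. f h \<partial>history_law r t) = (\<integral>h. f h * indicator {h. length h = t} h \<partial>history_law r t)"
    using AE_history_law_length[of t r] by (intro integral_cong_AE) auto
  also have "\<dots> = (\<Sum>h | length h = t. f h * measure (history_law r t) {h})"
    by (rule integral_indicator_finite_real) (simp_all add: finite_histories emeasure_eq_measure)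
  finally show ?thesis .
qed

lemma integral_history_law_mono:
  assumes "\<And>h. length h = t \<Longrightarrow> f h \<le> (g h :: real)"
  shows "(\<integral>h. f h \<partial>history_law r t) \<le> (\<integral>h. g h \<partial>history_law r t)"
  unfolding integral_history_law using assms by (intro sum_mono mult_right_mono) auto

text \<open>For rewards in the unit interval this is the conditional expectation of \<open>f\<close>
  after the next round, given the history \<open>h\<close>.\<close>

definition round_mean :: "(arm \<Rightarrow> real \<Rightarrow> real) \<Rightarrow> (history \<Rightarrow> real) \<Rightarrow> history \<Rightarrow> real" where
  "round_mean r f h = (\<Sum>i\<in>UNIV. play_prob h i *
     (r i (play_prob h i) * f (h @ [(i, True)]) + (1 - r i (play_prob h i)) * f (h @ [(i, False)])))"

lemma round_mean_arms:
  "round_mean r f h =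
     play_prob h Arm1 * (r Arm1 (play_prob h Arm1) * f (h @ [(Arm1, True)])
       + (1 - r Arm1 (play_prob h Arm1)) * f (h @ [(Arm1, False)]))
   + play_prob h Arm2 * (r Arm2 (play_prob h Arm2) * f (h @ [(Arm2, True)])
       + (1 - r Arm2 (play_prob h Arm2)) * f (h @ [(Arm2, False)]))"
  by (simp add: round_mean_def UNIV_arm)

text \<open>\<open>bernoulli_pmf\<close> clips its parameter to the unit interval; under this
  condition the clipping has no effect and the weights in \<open>round_mean\<close> are the true
  ones.\<close>

definition bernoulli_rewards :: "(arm \<Rightarrow> real \<Rightarrow> real) \<Rightarrow> bool" where
  "bernoulli_rewards r \<longleftrightarrow> (\<forall>i p. 0 \<le> p \<longrightarrow> p \<le> 1 \<longrightarrow> 0 \<le> r i p \<and> r i p \<le> 1)"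

text \<open>The tower property. Nonempty histories split uniquely into an initial part and a last
  round, so the sum over length \<open>Suc t\<close> becomes a double sum. The growth of every
  expected count below is read off from it.\<close>

lemma integral_history_law_Suc:
  assumes r: "bernoulli_rewards r"
  shows "(\<integral>h. f h \<partial>history_law r (Suc t)) = (\<integral>h. round_mean r f h \<partial>history_law r t)"
proof -
  have w: "measure (history_law r (Suc t)) {h @ [(i, x)]}
      = measure (history_law r t) {h} * (play_prob h i * pmf (bernoulli_pmf (r i (play_prob h i))) x)"
    for h i x
    using emeasure_history_law_Suc[of r t h i x]
    by (simp add: measure_def enn2real_mult play_prob_nonneg)
  have inj: "inj_on (\<lambda>(h, z). h @ [z]) ({h :: history. length h = t} \<times> UNIV)"
    by (auto simp: inj_on_def)
  have img: "{h :: history. length h = Suc t} = (\<lambda>(h, z). h @ [z]) ` ({h. length h = t} \<times> UNIV)"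
    by (force simp: length_Suc_conv_rev)
  have "(\<integral>h. f h \<partial>history_law r (Suc t))
      = (\<Sum>h | length h = t. \<Sum>z\<in>UNIV. f (h @ [z]) * measure (history_law r (Suc t)) {h @ [z]})"
    unfolding integral_history_law img
    by (subst sum.reindex[OF inj]) (simp add: sum.cartesian_product case_prod_unfold)
  also have "\<dots> = (\<Sum>h | length h = t. round_mean r f h * measure (history_law r t) {h})"
  proof (intro sum.cong refl)
    fix h :: history
    have "0 \<le> r i (play_prob h i) \<and> r i (play_prob h i) \<le> 1" for i
      using r play_prob_nonneg play_prob_le_1 by (simp add: bernoulli_rewards_def)
    then show "(\<Sum>z\<in>UNIV. f (h @ [z]) * measure (history_law r (Suc t)) {h @ [z]})
        = round_mean r f h * measure (history_law r t) {h}"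
      unfolding round_mean_arms
      by (simp add: UNIV_Times_UNIV[symmetric] sum.cartesian_product[symmetric] UNIV_arm UNIV_bool w
          del: UNIV_Times_UNIV history_law.simps) (simp add: algebra_simps)
  qed
  finally show ?thesis by (simp add: integral_history_law)
qed

text \<open>Later rounds do not change the law of the first \<open>t\<close>: a function that
  ignores the last entry is its own \<open>round_mean\<close>, because the play probabilities sum to
  1.\<close>

lemma integral_history_law_take:
  assumes r: "bernoulli_rewards r" and "t \<le> T"
  shows "(\<integral>h. f (take t h) \<partial>history_law r T) = (\<integral>h. (f h :: real) \<partial>history_law r t)"
  using \<open>t \<le> T\<close>
proof (induction T rule: dec_induct)
  case base
  show ?case unfolding integral_history_law by (intro sum.cong) auto
next
  case (step T)
  have "(\<integral>h. f (take t h) \<partial>history_law r (Suc T)) = (\<integral>h. f (take t h) \<partial>history_law r T)"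
    unfolding integral_history_law_Suc[OF r] unfolding integral_history_law
    using step.hyps by (intro sum.cong) (auto simp: round_mean_arms play_prob_Arm1 algebra_simps)
  then show ?case using step.IH by simp
qed

lemma successes_failures_snoc [simp]:
  "successes (h @ [(i, x)]) j = successes h j + (if i = j \<and> x then 1 else 0)"
  "failures (h @ [(i, x)]) j = failures h j + (if i = j \<and> \<not> x then 1 else 0)"
  by (auto simp: successes_def failures_def)

lemma length_history:
  "length h = successes h Arm1 + failures h Arm1 + (successes h Arm2 + failures h Arm2)"
proof (induction h rule: rev_induct)
  case (snoc z h)
  then show ?case by (cases z; cases "fst z") auto
qed (simp add: successes_def failures_def)

section \<open>The utility gap of the instance and its effect on the regret\<close>

lemma bernoulli_rewards_instance:
  assumes "0 < \<epsilon>" "\<epsilon> < 1 / 2"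
  shows "bernoulli_rewards (instance_reward \<epsilon>)"
  unfolding bernoulli_rewards_def
proof (intro allI impI)
  fix i :: arm and p :: real
  assume "0 \<le> p" "p \<le> 1"
  then show "0 \<le> instance_reward \<epsilon> i p \<and> instance_reward \<epsilon> i p \<le> 1"
    using assms by (cases i) (auto simp: field_simps)
qed

text \<open>The value \<open>1 - \<epsilon> / 2\<close> is the utility of the strategy with
  \<open>p Arm2 = \<epsilon>\<close>. On either side of that point the gap factors as the distance
  to \<epsilon> times a quotient that is at least \<open>1 / 2\<close>.\<close>

lemma utility_instance_gap:
  assumes \<epsilon>: "0 < \<epsilon>" "\<epsilon> < 1 / 2"
    and s: "0 \<le> p Arm2" "p Arm2 \<le> 1" "p Arm1 = 1 - p Arm2"
  shows "\<bar>p Arm2 - \<epsilon>\<bar> / 2 \<le> 1 - \<epsilon> / 2 - utility (instance_reward \<epsilon>) p"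
proof (cases "p Arm2 \<le> \<epsilon>")
  case True
  define s where "s = p Arm2"
  \<comment> \<open>At \<open>s = \<epsilon>\<close> the first reward takes its other branch, where
    both formulas agree; hence the case split.\<close>
  have u: "utility (instance_reward \<epsilon>) p = (1 - s) * (1 - \<epsilon> + s) + s\<^sup>2 / (2 * \<epsilon>)"
    using \<epsilon> s True by (cases "s = \<epsilon>") (auto simp: utility_def s_def power2_eq_square)
  have gap: "1 - \<epsilon> / 2 - utility (instance_reward \<epsilon>) p = (\<epsilon> - s) * ((\<epsilon> + s - 2 * \<epsilon> * s) / (2 * \<epsilon>))"
    unfolding u using \<epsilon> by (simp add: field_simps power2_eq_square)
  have "\<epsilon> * s \<le> 1 / 2 * s"
    using \<epsilon> s by (intro mult_right_mono) (auto simp: s_def)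
  then have "1 / 2 \<le> (\<epsilon> + s - 2 * \<epsilon> * s) / (2 * \<epsilon>)"
    using \<epsilon> by (simp add: field_simps)
  then have "(\<epsilon> - s) * (1 / 2) \<le> (\<epsilon> - s) * ((\<epsilon> + s - 2 * \<epsilon> * s) / (2 * \<epsilon>))"
    using True by (intro mult_left_mono) (auto simp: s_def)
  then show ?thesis
    unfolding gap using True by (simp add: s_def abs_if)
next
  case False
  define d where "d = p Arm2 - \<epsilon>"
  have u: "utility (instance_reward \<epsilon>) p = (1 - \<epsilon> - d)\<^sup>2 / (1 - \<epsilon>) + (\<epsilon> + d) * (1 - d) / 2"
    using \<epsilon> s False by (auto simp: utility_def d_def power2_eq_square)
  have gap: "1 - \<epsilon> / 2 - utility (instance_reward \<epsilon>) p
      = d * (((1 - \<epsilon>) * (3 + \<epsilon> + d) - 2 * d) / (2 * (1 - \<epsilon>)))"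
    unfolding u using \<epsilon> by (simp add: field_simps power2_eq_square)
  have "(1 - \<epsilon>) * 1 \<le> (1 - \<epsilon>) * (1 + \<epsilon> + d)"
    using \<epsilon> False by (intro mult_left_mono) (auto simp: d_def)
  \<comment> \<open>From \<open>p Arm2 \<le> 1\<close> follows
    \<open>d \<le> 1 - \<epsilon>\<close>, so the extra \<open>2 * (1 - \<epsilon>)\<close> pays for
    \<open>2 * d\<close>.\<close>
  then have "1 - \<epsilon> \<le> (1 - \<epsilon>) * (3 + \<epsilon> + d) - 2 * d"
    using s by (simp add: d_def algebra_simps)
  then have "1 / 2 \<le> ((1 - \<epsilon>) * (3 + \<epsilon> + d) - 2 * d) / (2 * (1 - \<epsilon>))"
    using \<epsilon> by (simp add: field_simps)
  then have "d * (1 / 2) \<le> d * (((1 - \<epsilon>) * (3 + \<epsilon> + d) - 2 * d) / (2 * (1 - \<epsilon>)))"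
    using False by (intro mult_left_mono) (auto simp: d_def)
  then show ?thesis
    unfolding gap using False by (simp add: d_def abs_if)
qed

text \<open>The expected distance to the optimal strategy in round \<open>t\<close>. The regret and
  the errors in all expected counts are bounded in terms of this one sequence.\<close>

definition deviation :: "real \<Rightarrow> nat \<Rightarrow> real" where
  "deviation \<epsilon> t = (\<integral>h. \<bar>play_prob h Arm2 - \<epsilon>\<bar> \<partial>history_law (instance_reward \<epsilon>) t)"

lemma deviation_nonneg: "0 \<le> deviation \<epsilon> t"
  by (simp add: deviation_def)

lemma regret_instance_ge:
  assumes \<epsilon>: "0 < \<epsilon>" "\<epsilon> < 1 / 2"
  shows "(\<Sum>t<T. deviation \<epsilon> t) / 2 \<le> regret (instance_reward \<epsilon>) T"
proof -
  let ?r = "instance_reward \<epsilon>" and ?U = "1 - \<epsilon> / 2"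
  note [simp] = integrable_history_law
  have bound: "utility ?r p \<le> ?U" if "p \<in> mixed_strategies" for p
    using utility_instance_gap[OF \<epsilon>, of p] that by (auto simp: mixed_strategies_def)
  \<comment> \<open>Only a lower bound on the supremum is needed, and the optimal strategy is the
    witness. The upper bound \<open>bound\<close> serves to show that the set of utilities is
    bounded above.\<close>
  have "?U = utility ?r (\<lambda>i. case i of Arm1 \<Rightarrow> 1 - \<epsilon> | Arm2 \<Rightarrow> \<epsilon>)"
    using \<epsilon> by (simp add: utility_def)
  also have "\<dots> \<le> (SUP p\<in>mixed_strategies. utility ?r p)"
    using \<epsilon> bound by (intro cSUP_upper bdd_aboveI2) (auto simp: mixed_strategies_def)
  finally have sup: "real T * ?U \<le> real T * (SUP p\<in>mixed_strategies. utility ?r p)"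
    by (rule mult_left_mono) simp
  have "(\<integral>h. (\<Sum>t<T. utility ?r (play_prob (take t h))) \<partial>history_law ?r T)
      = (\<Sum>t<T. \<integral>h. utility ?r (play_prob h) \<partial>history_law ?r t)"
    using integral_history_law_take[OF bernoulli_rewards_instance[OF \<epsilon>],
        where f = "\<lambda>h. utility ?r (play_prob h)"]
    by (subst Bochner_Integration.integral_sum) (auto intro!: sum.cong)
  also have "\<dots> \<le> (\<Sum>t<T. ?U - deviation \<epsilon> t / 2)"
  proof (rule sum_mono)
    fix t
    have "(\<integral>h. utility ?r (play_prob h) \<partial>history_law ?r t)
        \<le> (\<integral>h. ?U - \<bar>play_prob h Arm2 - \<epsilon>\<bar> / 2 \<partial>history_law ?r t)"
    proof (rule integral_history_law_mono)
      fix h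
      show "utility ?r (play_prob h) \<le> ?U - \<bar>play_prob h Arm2 - \<epsilon>\<bar> / 2"
        using utility_instance_gap[OF \<epsilon>, of "play_prob h"]
        by (simp add: play_prob_nonneg play_prob_le_1 play_prob_Arm1)
    qed
    then show "(\<integral>h. utility ?r (play_prob h) \<partial>history_law ?r t) \<le> ?U - deviation \<epsilon> t / 2"
      by (simp add: deviation_def)
  qed
  finally show ?thesis
    using sup by (simp add: regret_def sum_subtractf sum_divide_distrib)
qed

section \<open>Growth of the expected counts, up to accumulated deviation\<close>

text \<open>The first reward peaks at 1 for \<open>p = 1 - \<epsilon>\<close> and has slopes of
  modulus at most \<open>1 / (1 - \<epsilon>) < 2\<close>, so a play of the first arm fails with
  probability at most \<open>2 * \<bar>s - \<epsilon>\<bar>\<close>.\<close>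

lemma expected_failures_Arm1_le:
  assumes \<epsilon>: "0 < \<epsilon>" "\<epsilon> < 1 / 2"
  shows "(\<integral>h. real (failures h Arm1) \<partial>history_law (instance_reward \<epsilon>) t)
    \<le> 2 * (\<Sum>u<t. deviation \<epsilon> u)"
proof (induction t)
  case 0
  show ?case unfolding integral_history_law by (simp add: failures_def)
next
  case (Suc t)
  let ?r = "instance_reward \<epsilon>"
  note [simp] = integrable_history_law
  have "(\<integral>h. real (failures h Arm1) \<partial>history_law ?r (Suc t))
      \<le> (\<integral>h. real (failures h Arm1) + 2 * \<bar>play_prob h Arm2 - \<epsilon>\<bar> \<partial>history_law ?r t)"
    unfolding integral_history_law_Suc[OF bernoulli_rewards_instance[OF \<epsilon>]]
  proof (rule integral_history_law_mono)
    fix h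
    let ?s = "play_prob h Arm2"
    have "1 - ?r Arm1 (1 - ?s) \<le> 2 * \<bar>?s - \<epsilon>\<bar>" "0 \<le> 1 - ?r Arm1 (1 - ?s)"
    proof -
      have "(?s - \<epsilon>) / (1 - \<epsilon>) \<le> 2 * (?s - \<epsilon>)" if "\<epsilon> \<le> ?s"
      proof -
        have "(?s - \<epsilon>) * 1 \<le> (?s - \<epsilon>) * (2 * (1 - \<epsilon>))"
          using that \<epsilon> by (intro mult_left_mono) auto
        then show ?thesis using \<epsilon> by (simp add: field_simps)
      qed
      moreover have "1 - (1 - ?s) / (1 - \<epsilon>) = (?s - \<epsilon>) / (1 - \<epsilon>)"
        using \<epsilon> by (simp add: field_simps)
      ultimately show "1 - ?r Arm1 (1 - ?s) \<le> 2 * \<bar>?s - \<epsilon>\<bar>"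
        by auto
      show "0 \<le> 1 - ?r Arm1 (1 - ?s)"
        using bernoulli_rewards_instance[OF \<epsilon>] play_prob_nonneg[of h Arm2] play_prob_le_1[of h Arm2]
        unfolding bernoulli_rewards_def by (metis diff_ge_0_iff_ge diff_le_eq le_add_same_cancel1)
    qed
    then have "(1 - ?s) * (1 - ?r Arm1 (1 - ?s)) \<le> 1 * (2 * \<bar>?s - \<epsilon>\<bar>)"
      using play_prob_nonneg[of h Arm2] play_prob_le_1[of h Arm2] by (intro mult_mono) auto
    moreover have "round_mean ?r (\<lambda>h. real (failures h Arm1)) h
        = real (failures h Arm1) + (1 - ?s) * (1 - ?r Arm1 (1 - ?s))"
      by (simp add: round_mean_arms play_prob_Arm1 algebra_simps del: instance_reward.simps)
    ultimately show "round_mean ?r (\<lambda>h. real (failures h Arm1)) h \<le> real (failures h Arm1) + 2 * \<bar>?s - \<epsilon>\<bar>"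
      by linarith
  qed
  then show ?case
    using Suc by (simp add: deviation_def del: history_law.simps)
qed

lemma half_le_1_minus_instance_reward_Arm2:
  assumes "0 < \<epsilon>" "0 \<le> p"
  shows "1 / 2 \<le> 1 - instance_reward \<epsilon> Arm2 p"
  using assms by (auto simp: field_simps)

text \<open>The second reward never exceeds \<open>1 / 2\<close>, and the second arm is played with
  probability at least \<open>\<epsilon> - \<bar>s - \<epsilon>\<bar>\<close>.\<close>

lemma expected_failures_Arm2_ge:
  assumes \<epsilon>: "0 < \<epsilon>" "\<epsilon> < 1 / 2"
  shows "(\<epsilon> * real t - (\<Sum>u<t. deviation \<epsilon> u)) / 2
    \<le> (\<integral>h. real (failures h Arm2) \<partial>history_law (instance_reward \<epsilon>) t)"
proof (induction t)
  case 0
  show ?case by simp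
next
  case (Suc t)
  let ?r = "instance_reward \<epsilon>"
  note [simp] = integrable_history_law
  have "(\<integral>h. real (failures h Arm2) + (\<epsilon> - \<bar>play_prob h Arm2 - \<epsilon>\<bar>) / 2 \<partial>history_law ?r t)
      \<le> (\<integral>h. real (failures h Arm2) \<partial>history_law ?r (Suc t))"
    unfolding integral_history_law_Suc[OF bernoulli_rewards_instance[OF \<epsilon>]]
  proof (rule integral_history_law_mono)
    fix h
    let ?s = "play_prob h Arm2"
    have "(\<epsilon> - \<bar>?s - \<epsilon>\<bar>) / 2 \<le> ?s * (1 / 2)"
      by (cases "\<epsilon> \<le> ?s") auto
    also have "\<dots> \<le> ?s * (1 - ?r Arm2 ?s)"
      by (intro mult_left_mono half_le_1_minus_instance_reward_Arm2 \<epsilon> play_prob_nonneg)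
    finally have "(\<epsilon> - \<bar>?s - \<epsilon>\<bar>) / 2 \<le> ?s * (1 - ?r Arm2 ?s)" .
    moreover have "round_mean ?r (\<lambda>h. real (failures h Arm2)) h
        = real (failures h Arm2) + ?s * (1 - ?r Arm2 ?s)"
      by (simp add: round_mean_arms play_prob_Arm1 algebra_simps del: instance_reward.simps)
    ultimately show "real (failures h Arm2) + (\<epsilon> - \<bar>?s - \<epsilon>\<bar>) / 2
        \<le> round_mean ?r (\<lambda>h. real (failures h Arm2)) h"
      by (simp only: add_left_mono)
  qed
  then show ?case
    using Suc by (simp add: deviation_def algebra_simps diff_divide_distrib add_divide_distrib del: history_law.simps)
qed

abbreviation plays :: "history \<Rightarrow> arm \<Rightarrow> nat" where
  "plays h i \<equiv> successes h i + failures h i"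

text \<open>The two counts are dependent, so the product is followed through its own drift. It grows
  by \<open>failures h Arm2\<close> when the first arm is played, with probability
  \<open>1 - s \<ge> 1 / 2 - \<bar>s - \<epsilon>\<bar>\<close>; the growth from new failures of the
  second arm is nonnegative and dropped.\<close>

lemma expected_plays_times_failures_Suc:
  assumes \<epsilon>: "0 < \<epsilon>" "\<epsilon> < 1 / 2"
  shows "(\<integral>h. real (plays h Arm1) * real (failures h Arm2) \<partial>history_law (instance_reward \<epsilon>) t)
      + ((\<epsilon> * real t - (\<Sum>u<t. deviation \<epsilon> u)) / 4 - real t * deviation \<epsilon> t)
    \<le> (\<integral>h. real (plays h Arm1) * real (failures h Arm2) \<partial>history_law (instance_reward \<epsilon>) (Suc t))"
proof -
  let ?r = "instance_reward \<epsilon>" and ?\<Phi> = "\<lambda>h. real (plays h Arm1) * real (failures h Arm2)"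
  note [simp] = integrable_history_law
  have "(\<integral>h. ?\<Phi> h + (real (failures h Arm2) / 2 - real t * \<bar>play_prob h Arm2 - \<epsilon>\<bar>) \<partial>history_law ?r t)
      \<le> (\<integral>h. ?\<Phi> h \<partial>history_law ?r (Suc t))"
    unfolding integral_history_law_Suc[OF bernoulli_rewards_instance[OF \<epsilon>]]
  proof (rule integral_history_law_mono)
    fix h :: history
    assume len: "length h = t"
    let ?s = "play_prob h Arm2" and ?F = "real (failures h Arm2)" and ?n = "real (plays h Arm1)"
    have "0 \<le> ?s * (1 - ?r Arm2 ?s)"
      by (rule mult_nonneg_nonneg[OF play_prob_nonneg
            order_trans[OF _ half_le_1_minus_instance_reward_Arm2[OF \<epsilon>(1) play_prob_nonneg]]]) simp
    then have "0 \<le> ?n * (?s * (1 - ?r Arm2 ?s))"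
      by (rule mult_nonneg_nonneg[OF of_nat_0_le_iff])
    moreover have "?F * (1 / 2 - \<bar>?s - \<epsilon>\<bar>) \<le> ?F * (1 - ?s)"
      using \<epsilon> by (intro mult_left_mono) auto
    moreover have "?F * \<bar>?s - \<epsilon>\<bar> \<le> real t * \<bar>?s - \<epsilon>\<bar>"
      using length_history[of h] len by (intro mult_right_mono) auto
    moreover have "round_mean ?r ?\<Phi> h = ?\<Phi> h + ?F * (1 - ?s) + ?n * (?s * (1 - ?r Arm2 ?s))"
      by (simp add: round_mean_arms play_prob_Arm1 algebra_simps del: instance_reward.simps)
    ultimately show "?\<Phi> h + (?F / 2 - real t * \<bar>?s - \<epsilon>\<bar>) \<le> round_mean ?r ?\<Phi> h"
      by (simp add: right_diff_distrib del: of_nat_add)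
  qed
  then have "(\<integral>h. ?\<Phi> h \<partial>history_law ?r t)
        + ((\<integral>h. real (failures h Arm2) \<partial>history_law ?r t) / 2 - real t * deviation \<epsilon> t)
      \<le> (\<integral>h. ?\<Phi> h \<partial>history_law ?r (Suc t))"
    by (simp add: deviation_def del: history_law.simps of_nat_add)
  then show ?thesis
    using expected_failures_Arm2_ge[OF \<epsilon>, of t] by argo
qed

text \<open>Summing the drift over \<open>u < t\<close>: the terms \<open>\<epsilon> * u / 4\<close>
  give the main term. The accumulated deviations cost at most \<open>1 / 4\<close>, and the terms
  \<open>u * deviation \<epsilon> u\<close> at most 1, times \<open>t\<close> times the total
  deviation; together \<open>5 / 4\<close>.\<close>

lemma expected_plays_times_failures_ge:
  assumes \<epsilon>: "0 < \<epsilon>" "\<epsilon> < 1 / 2"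
  shows "\<epsilon> / 8 * (real t * (real t - 1)) - 5 / 4 * (real t * (\<Sum>u<t. deviation \<epsilon> u))
    \<le> (\<integral>h. real (plays h Arm1) * real (failures h Arm2) \<partial>history_law (instance_reward \<epsilon>) t)"
proof (induction t)
  case 0
  show ?case by simp
next
  case (Suc t)
  let ?D = "\<Sum>u<t. deviation \<epsilon> u" and ?d = "deviation \<epsilon> t"
  have "0 \<le> ?D + 5 / 4 * ?d + real t * ?d / 4"
    by (intro add_nonneg_nonneg) (simp_all add: sum_nonneg deviation_nonneg)
  moreover have "\<epsilon> / 8 * (real (Suc t) * (real (Suc t) - 1)) - 5 / 4 * (real (Suc t) * (?D + ?d))
      = (\<epsilon> / 8 * (real t * (real t - 1)) - 5 / 4 * (real t * ?D))
        + ((\<epsilon> * real t - ?D) / 4 - real t * ?d) - (?D + 5 / 4 * ?d + real t * ?d / 4)"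
    by (simp add: field_simps)
  ultimately show ?case
    using Suc expected_plays_times_failures_Suc[OF \<epsilon>, of t] by (simp only: sum.lessThan_Suc)
qed

section \<open>The contradiction with sublinear regret\<close>

text \<open>The posterior bound with denominators cleared, so that it also covers histories without
  a failure of the second arm and its expectation can be taken term by term.\<close>

lemma play_prob_times_plays_le:
  "play_prob h Arm2 * (real (plays h Arm1) * real (failures h Arm2))
    \<le> (real (failures h Arm1) + 1) * (real (length h) + 1)"
proof (cases "failures h Arm2 = 0")
  case False
  let ?s = "play_prob h Arm2" and ?F = "real (failures h Arm2)" and ?n = "real (plays h Arm1)"
  have "?s * (?n * ?F) \<le> ?s * ((?n + 2) * ?F)"
    by (intro mult_left_mono mult_right_mono play_prob_nonneg) auto
  also have "\<dots> \<le> (real (failures h Arm1) + 1) * (real (plays h Arm2) + 1)"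
  proof -
    have "?s \<le> (real (failures h Arm1) + 1) * (real (plays h Arm2) + 1) / ((?n + 2) * ?F)"
      using play_prob_Arm2_le[of h] False by simp
    then show ?thesis
      using False by (subst (asm) pos_le_divide_eq) auto
  qed
  also have "\<dots> \<le> (real (failures h Arm1) + 1) * (real (length h) + 1)"
    by (intro mult_left_mono) (auto simp: length_history)
  finally show ?thesis .
qed simp

text \<open>In the expectation of the preceding bound, \<open>s\<close> is replaced by
  \<open>\<epsilon> - \<bar>s - \<epsilon>\<bar>\<close>. The product of counts is at most
  \<open>t * t\<close>, which prices this replacement. The bounds on the expected counts then leave
  an inequality in deviations alone.\<close>

lemma deviation_inequality:
  assumes \<epsilon>: "0 < \<epsilon>" "\<epsilon> < 1 / 2"
  shows "\<epsilon> * (\<epsilon> / 8 * (real t * (real t - 1)) - 5 / 4 * (real t * (\<Sum>u<t. deviation \<epsilon> u)))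
      - (real t)\<^sup>2 * deviation \<epsilon> t
    \<le> (2 * (\<Sum>u<t. deviation \<epsilon> u) + 1) * (real t + 1)"
proof -
  let ?r = "instance_reward \<epsilon>" and ?\<Phi> = "\<lambda>h. real (plays h Arm1) * real (failures h Arm2)"
  note [simp] = integrable_history_law
  have "(\<integral>h. \<epsilon> * ?\<Phi> h - (real t)\<^sup>2 * \<bar>play_prob h Arm2 - \<epsilon>\<bar> \<partial>history_law ?r t)
      \<le> (\<integral>h. (real (failures h Arm1) + 1) * (real t + 1) \<partial>history_law ?r t)"
  proof (rule integral_history_law_mono)
    fix h :: history
    assume len: "length h = t"
    let ?s = "play_prob h Arm2"
    have "?\<Phi> h \<le> real t * real t"
      using length_history[of h] len by (intro mult_mono) auto
    then have "?\<Phi> h * \<bar>?s - \<epsilon>\<bar> \<le> (real t)\<^sup>2 * \<bar>?s - \<epsilon>\<bar>"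
      by (intro mult_right_mono) (auto simp: power2_eq_square)
    moreover have "?\<Phi> h * (\<epsilon> - \<bar>?s - \<epsilon>\<bar>) \<le> ?\<Phi> h * ?s"
      by (intro mult_left_mono mult_nonneg_nonneg) auto
    ultimately show "\<epsilon> * ?\<Phi> h - (real t)\<^sup>2 * \<bar>?s - \<epsilon>\<bar> \<le> (real (failures h Arm1) + 1) * (real t + 1)"
      using play_prob_times_plays_le[of h] len
      by (simp add: algebra_simps del: of_nat_add)
  qed
  then have "\<epsilon> * (\<integral>h. ?\<Phi> h \<partial>history_law ?r t) - (real t)\<^sup>2 * deviation \<epsilon> t
      \<le> ((\<integral>h. real (failures h Arm1) \<partial>history_law ?r t) + 1) * (real t + 1)"
    by (simp add: deviation_def del: of_nat_add)
  also have "\<dots> \<le> (2 * (\<Sum>u<t. deviation \<epsilon> u) + 1) * (real t + 1)"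
    using expected_failures_Arm1_le[OF \<epsilon>, of t] by (intro mult_right_mono) auto
  finally show ?thesis
    using mult_left_mono[OF expected_plays_times_failures_ge[OF \<epsilon>, of t], of \<epsilon>] \<epsilon> by linarith
qed

theorem lemmaC1:
  fixes \<epsilon> :: real
  assumes "0 < \<epsilon>" and "\<epsilon> < 1 / 2"
  shows "linear_regret (regret (instance_reward \<epsilon>))"
  unfolding linear_regret_def
proof
  note \<epsilon> = assms
  let ?D = "\<lambda>t. \<Sum>u<t. deviation \<epsilon> u"
  \<comment> \<open>The error terms below add up to \<open>6 * \<delta> * t * t\<close>. This choice
    makes them half of the main term \<open>\<epsilon>\<^sup>2 / 8 * t * t\<close>.\<close>
  define \<delta> where "\<delta> = \<epsilon>\<^sup>2 / 96"
  have \<delta>: "0 < \<delta>" using \<epsilon> by (simp add: \<delta>_def)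
  assume "regret (instance_reward \<epsilon>) \<in> o(\<lambda>T. real T)"
  then have "\<forall>\<^sub>F T in sequentially. norm (regret (instance_reward \<epsilon>) T) \<le> \<delta> / 4 * norm (real T)"
    by (rule landau_o.smallD) (use \<delta> in simp)
  then obtain N where N: "\<And>T. N \<le> T \<Longrightarrow> regret (instance_reward \<epsilon>) T \<le> \<delta> / 4 * real T"
    unfolding eventually_sequentially by fastforce
  have D: "?D T \<le> \<delta> / 2 * real T" if "N \<le> T" for T
    using N[OF that] regret_instance_ge[OF \<epsilon>, of T] by linarith
  obtain M where M: "N \<le> M" "48 / \<epsilon>\<^sup>2 < real M" "1 \<le> M"
    by (meson real_arch_simple reals_Archimedean2 le_trans max.cobounded1 max.cobounded2
        less_le_trans of_nat_mono)
  \<comment> \<open>Averaging over a window of length \<open>2 * M\<close>: deviations all above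
    \<delta> would sum to at least \<open>2 * M * \<delta>\<close>, while \<open>D\<close> at
    \<open>3 * M\<close> allows only \<open>3 / 2 * M * \<delta>\<close>.\<close>
  have "\<exists>t\<ge>M. deviation \<epsilon> t \<le> \<delta>"
  proof (rule ccontr)
    assume "\<not> ?thesis"
    then have "(\<Sum>t=M..<3 * M. \<delta>) \<le> (\<Sum>t=M..<3 * M. deviation \<epsilon> t)"
      by (intro sum_mono) force
    also have "\<dots> \<le> ?D (3 * M)"
      by (intro sum_mono2) (auto simp: deviation_nonneg)
    also have "\<dots> \<le> \<delta> / 2 * real (3 * M)"
      by (rule D) (use M in simp)
    finally show False using \<delta> M by (simp add: field_simps)
  qed
  then obtain t where t: "M \<le> t" "deviation \<epsilon> t \<le> \<delta>" by blast
  have Dt: "?D t \<le> \<delta> * real t"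
  proof -
    have "\<delta> / 2 * real t \<le> \<delta> * real t" using \<delta> by simp
    then show ?thesis using D[of t] t M by linarith
  qed
  have t1: "1 \<le> real t" and t48: "48 / \<epsilon>\<^sup>2 < real t"
    using t M by (linarith, linarith)
  \<comment> \<open>The crude bound \<open>\<epsilon> \<le> 4 / 5\<close> cancels the factor
    \<open>5 / 4\<close>.\<close>
  have "\<epsilon> * (5 / 4 * (real t * ?D t)) \<le> 4 / 5 * (5 / 4 * (real t * (\<delta> * real t)))"
    using \<epsilon> Dt by (intro mult_mono mult_left_mono) (auto simp: sum_nonneg deviation_nonneg)
  moreover have "(real t)\<^sup>2 * deviation \<epsilon> t \<le> (real t)\<^sup>2 * \<delta>"
    using t by (intro mult_left_mono) auto
  moreover have "(2 * ?D t + 1) * (real t + 1) \<le> (2 * (\<delta> * real t) + 1) * (2 * real t)"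
    using Dt t1 \<delta> by (intro mult_mono) auto
  ultimately have "real t * (\<epsilon>\<^sup>2 / 8 * (real t - 1)) \<le> real t * (6 * \<delta> * real t + 2)"
    using deviation_inequality[OF \<epsilon>, of t]
    by (simp add: algebra_simps power2_eq_square)
  then have "\<epsilon>\<^sup>2 / 8 * (real t - 1) \<le> 6 * \<delta> * real t + 2"
    using t1 by simp
  moreover have "\<epsilon>\<^sup>2 \<le> 1" using \<epsilon> by (simp add: power_le_one)
  \<comment> \<open>What remains is
    \<open>\<epsilon>\<^sup>2 * t / 16 \<le> 2 + \<epsilon>\<^sup>2 / 8\<close>. The left side now
    exceeds 3 and the right side is at most \<open>17 / 8\<close>.\<close>
  moreover have "48 < \<epsilon>\<^sup>2 * real t"
    using t48 \<epsilon> by (simp add: field_simps)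
  ultimately show False by (simp add: \<delta>_def algebra_simps)
qed

end
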